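(* Let $g\in C^1(\mathbb{R}^d)$ and $f\in C^3(\mathbb{R}^m)$. The distribution $\pi^\ast=(\mathrm{id},\nabla f\circ K)_{\#}\mu^\ast$ on $\mathbb{R}^d\times\mathbb{R}^m$ is a stationary solution of the modified weak Fokker-Planck equation $$\frac{\mathrm{d}}{\mathrm{d}t}\int\phi\,\mathrm{d}\pi_t=\int\nabla_z\cdot\left(\Sigma_{\mathrm{mod}}(z)\nabla_z\phi\right)\mathrm{d}\pi_t-\int\nabla_z\phi\cdot A_{\mathrm{mod}}(z)\,\mathrm{d}\pi_t\qquad\text{for all }\phi\in C_c^\infty(\mathbb{R}^d\times\mathbb{R}^m),$$ i.e. the right-hand side vanishes for every such $\phi$ when $\pi_t=\pi^\ast$.
   Context: $K:\mathbb{R}^d\to\mathbb{R}^m$ is linear, $f:\mathbb{R}^m\to\mathbb{R}$ and $g:\mathbb{R}^d\to\mathbb{R}$ are convex with $0<\int\exp(-f(Kx)-g(x))dx<\infty$, and $\mu^\ast$ is the probability distribution with density proportional to $\exp(-f(Kx)-g(x))$. $f^\ast$ is the convex conjugate of $f$, assumed differentiable with $\nabla f^\ast=(\nabla f)^{-1}$. $\lambda>0$. Write $z=(x,y)$ and $$M(x)=K^TH_f(Kx)\in\mathbb{R}^{d\times m},$$ with $H_f$ the Hessian of $f$ (so $M(x)^T$ is the Jacobian of $\nabla f\circ K$ at $x$). The coefficients are $$A_{\mathrm{mod}}(z)=\begin{pmatrix}\nabla g(x)+K^Ty\\ \lambda(\nabla f^\ast(y)-Kx)+M(x)^T(\nabla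 g(x)+K^T\nabla f(Kx))\end{pmatrix},\qquad B_{\mathrm{mod}}(z)=\sqrt2\begin{pmatrix}I\\ M(x)^T\end{pmatrix},$$ $$\Sigma_{\mathrm{mod}}(z)=\tfrac12B_{\mathrm{mod}}B_{\mathrm{mod}}^T=\begin{pmatrix}I&M(x)\\ M(x)^T&M(x)^TM(x)\end{pmatrix}.$$ $(\mathrm{id},\nabla f\circ K)_{\#}\mu^\ast$ is the push-forward of $\mu^\ast$ under $x\mapsto(x,\nabla f(Kx))$. *)

theory Defs
  imports "HOL-Probability.Probability"
begin

definition grad :: "('a::euclidean_space \<Rightarrow> real) \<Rightarrow> 'a \<Rightarrow> 'a" where
  "grad f x = (THE D. GDERIV f x :> D)"

lemma gderiv_imp_grad:
  fixes f :: "'a::euclidean_space \<Rightarrow> real"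
  assumes "GDERIV f x :> D"
  shows "grad f x = D"
  unfolding grad_def
proof (rule the_equality)
  show "GDERIV f x :> D" by fact
  fix D' assume "GDERIV f x :> D'"
  then have "(\<lambda>h. h \<bullet> D') = (\<lambda>h. h \<bullet> D)"
    using assms unfolding gderiv_def by (rule has_derivative_unique)
  then have "\<forall>h. h \<bullet> D' = h \<bullet> D" by (intro allI) (rule fun_cong)
  then show "D' = D" by (rule iffD1[OF vector_eq_ldot])
qed

lemma differentiable_imp_gderiv_grad:
  fixes f :: "'a::euclidean_space \<Rightarrow> real"
  assumes "f differentiable (at x)"
  shows "GDERIV f x :> grad f x"
proof -
  define L where "L = frechet_derivative f (at x)"
  have L: "(f has_derivative L) (at x)"
    using assms unfolding L_def by (simp add: frechet_derivative_works)
  have "L h = h \<bullet> adjoint L 1" for h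
    using adjoint_works[OF has_derivative_linear[OF L], of h 1] by simp
  then obtain w where "\<And>h. L h = h \<bullet> w" by blast
  then have "L = (\<lambda>h. h \<bullet> w)" by (rule ext)
  then have D: "GDERIV f x :> w"
    using L by (simp add: gderiv_def)
  then have "grad f x = w" by (rule gderiv_imp_grad)
  then show ?thesis using D by simp
qed

definition hessian :: "(real^'m \<Rightarrow> real) \<Rightarrow> real^'m \<Rightarrow> real^'m^'m" where
  "hessian f x = matrix (frechet_derivative (grad f) (at x))"

definition divergence :: "('a::euclidean_space \<Rightarrow> 'a) \<Rightarrow> 'a \<Rightarrow> real" where
  "divergence F z = (\<Sum>b\<in>Basis. frechet_derivative F (at z) b \<bullet> b)"

(* In finite dimension, continuity of all directional derivatives is continuity
   of the total derivative, so this is the usual class C^k. *)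
primrec Ck :: "nat \<Rightarrow> ('a::euclidean_space \<Rightarrow> real) \<Rightarrow> bool" where
  "Ck 0 f \<longleftrightarrow> continuous_on UNIV f"
| "Ck (Suc k) f \<longleftrightarrow> (\<forall>x. f differentiable (at x)) \<and>
     (\<forall>v. Ck k (\<lambda>x. frechet_derivative f (at x) v))"

definition test_function :: "('a::euclidean_space \<Rightarrow> real) \<Rightarrow> bool" where
  "test_function \<phi> \<longleftrightarrow> (\<forall>k. Ck k \<phi>) \<and> compact (closure {z. \<phi> z \<noteq> 0})"

definition convex_conjugate :: "('a::real_inner \<Rightarrow> real) \<Rightarrow> 'a \<Rightarrow> ereal" where
  "convex_conjugate f y = (SUP x. ereal (y \<bullet> x - f x))"

(* Meaningful only where the conjugate is finite. *)
definition real_conjugate :: "('a::real_inner \<Rightarrow> real) \<Rightarrow> 'a \<Rightarrow> real" where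
  "real_conjugate f y = real_of_ereal (convex_conjugate f y)"

definition partition_function :: "(real^'m \<Rightarrow> real) \<Rightarrow> (real^'d \<Rightarrow> real) \<Rightarrow> real^'d^'m \<Rightarrow> ennreal" where
  "partition_function f g K = (\<integral>\<^sup>+x. ennreal (exp (- f (K *v x) - g x)) \<partial>lborel)"

definition mu_star :: "(real^'m \<Rightarrow> real) \<Rightarrow> (real^'d \<Rightarrow> real) \<Rightarrow> real^'d^'m \<Rightarrow> (real^'d) measure" where
  "mu_star f g K =
     density lborel (\<lambda>x. ennreal (exp (- f (K *v x) - g x)) / partition_function f g K)"

definition pi_star ::
    "(real^'m \<Rightarrow> real) \<Rightarrow> (real^'d \<Rightarrow> real) \<Rightarrow> real^'d^'m \<Rightarrow> ((real^'d) \<times> (real^'m)) measure" where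
  "pi_star f g K = distr (mu_star f g K) borel (\<lambda>x. (x, grad f (K *v x)))"

definition M_mat :: "(real^'m \<Rightarrow> real) \<Rightarrow> real^'d^'m \<Rightarrow> real^'d \<Rightarrow> real^'m^'d" where
  "M_mat f K x = transpose K ** hessian f (K *v x)"

definition A_mod :: "(real^'m \<Rightarrow> real) \<Rightarrow> (real^'d \<Rightarrow> real) \<Rightarrow> real^'d^'m \<Rightarrow> real \<Rightarrow>
    (real^'d) \<times> (real^'m) \<Rightarrow> (real^'d) \<times> (real^'m)" where
  "A_mod f g K lam z = (let x = fst z; y = snd z in
     (grad g x + transpose K *v y,
      lam *\<^sub>R (grad (real_conjugate f) y - K *v x)
        + transpose (M_mat f K x) *v (grad g x + transpose K *v grad f (K *v x))))"

(* Block matrices acting on pairs are represented by the corresponding linear maps. *)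
definition B_mod :: "(real^'m \<Rightarrow> real) \<Rightarrow> real^'d^'m \<Rightarrow>
    (real^'d) \<times> (real^'m) \<Rightarrow> real^'d \<Rightarrow> (real^'d) \<times> (real^'m)" where
  "B_mod f K z u = sqrt 2 *\<^sub>R (u, transpose (M_mat f K (fst z)) *v u)"

definition Sigma_mod :: "(real^'m \<Rightarrow> real) \<Rightarrow> real^'d^'m \<Rightarrow>
    (real^'d) \<times> (real^'m) \<Rightarrow> (real^'d) \<times> (real^'m) \<Rightarrow> (real^'d) \<times> (real^'m)" where
  "Sigma_mod f K z w = (1/2) *\<^sub>R B_mod f K z (adjoint (B_mod f K z) w)"

lemma Sigma_mod_block:
  fixes f :: "real^'m \<Rightarrow> real" and K :: "real^'d^'m"
  defines "M \<equiv> M_mat f K"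
  shows "Sigma_mod f K (x, y) (v, w) =
    (v + M x *v w, transpose (M x) *v v + (transpose (M x) ** M x) *v w)"
proof -
  define N where "N = M x"
  have B: "B_mod f K (x, y) u = sqrt 2 *\<^sub>R (u, transpose N *v u)" for u
    by (simp only: B_mod_def N_def M_def fst_conv)
  have "adjoint (B_mod f K (x, y)) = (\<lambda>p. sqrt 2 *\<^sub>R (fst p + N *v snd p))"
  proof (rule adjoint_unique, intro allI)
    fix u :: "real^'d" and p :: "(real^'d) \<times> (real^'m)"
    have "(transpose N *v u) \<bullet> snd p = u \<bullet> (N *v snd p)"
      by (simp only: transpose_matrix_vector dot_lmul_matrix)
    then show "B_mod f K (x, y) u \<bullet> p = u \<bullet> sqrt 2 *\<^sub>R (fst p + N *v snd p)"
      by (simp only: B inner_prod_def fst_scaleR snd_scaleR fst_conv snd_conv inner_scaleR_left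
          inner_scaleR_right inner_add_right distrib_left)
  qed
  then have "Sigma_mod f K (x, y) (v, w) = (v + N *v w, transpose N *v (v + N *v w))"
    by (simp add: Sigma_mod_def B matrix_vector_mult_scaleR del: transpose_matrix_vector)
  then show ?thesis
    by (simp only: N_def matrix_vector_right_distrib matrix_vector_mul_assoc)
qed

(* Right-hand side of the weak Fokker-Planck equation with drift -A and
   diffusion matrix S z, the latter given as a linear map. *)
definition fp_rhs :: "('z::euclidean_space \<Rightarrow> 'z \<Rightarrow> 'z) \<Rightarrow> ('z \<Rightarrow> 'z) \<Rightarrow> 'z measure \<Rightarrow> ('z \<Rightarrow> real) \<Rightarrow> real" where
  "fp_rhs S A p \<phi> =
     (\<integral>z. divergence (\<lambda>z. S z (grad \<phi> z)) z \<partial>p) - (\<integral>z. grad \<phi> z \<bullet> A z \<partial>p)"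

(* Bochner integrals are 0 for non-integrable functions, hence the explicit integrability. *)
definition weak_fp_solution ::
    "('z::euclidean_space \<Rightarrow> 'z \<Rightarrow> 'z) \<Rightarrow> ('z \<Rightarrow> 'z) \<Rightarrow> (real \<Rightarrow> 'z measure) \<Rightarrow> bool" where
  "weak_fp_solution S A p \<longleftrightarrow>
     (\<forall>t\<ge>0. prob_space (p t) \<and> sets (p t) = sets borel) \<and>
     (\<forall>\<phi>. test_function \<phi> \<longrightarrow> (\<forall>t\<ge>0.
        integrable (p t) (\<lambda>z. divergence (\<lambda>z. S z (grad \<phi> z)) z) \<and>
        integrable (p t) (\<lambda>z. grad \<phi> z \<bullet> A z) \<and>
        ((\<lambda>s. \<integral>z. \<phi> z \<partial>p s) has_real_derivative fp_rhs S A (p t) \<phi>) (at t within {0..})))"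

definition stationary_fp_solution ::
    "('z::euclidean_space \<Rightarrow> 'z \<Rightarrow> 'z) \<Rightarrow> ('z \<Rightarrow> 'z) \<Rightarrow> 'z measure \<Rightarrow> bool" where
  "stationary_fp_solution S A p \<longleftrightarrow> weak_fp_solution S A (\<lambda>t. p)"

end

theory Submission
  imports Defs
begin

text \<open>
  Write \<open>V x = f (K x) + g x\<close> for the potential, \<open>G x = \<nabla>f (K x)\<close> for the map whose graph
  carries \<open>\<pi>\<^sup>*\<close>, and \<open>M x = K\<^sup>T H\<^sub>f(K x)\<close>. The diffusion matrix is \<open>\<Sigma> = B B\<^sup>T / 2\<close> for the block
  column \<open>B\<close> with blocks \<open>\<surd>2 I\<close> and \<open>\<surd>2 M\<^sup>T\<close>, so that \<open>\<Sigma> \<nabla>\<phi> = (w, M\<^sup>T w)\<close> with the single vector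
  field \<open>w = \<nabla>\<^sub>x\<phi> + M \<nabla>\<^sub>y\<phi>\<close>: the noise acts only along the directions \<open>(u, M\<^sup>T u)\<close>. Because the
  Hessian of \<open>f\<close> is symmetric, \<open>M\<^sup>T = H\<^sub>f K\<close> is the Jacobian of \<open>G\<close>, and these directions are
  exactly the tangents to the graph of \<open>G\<close>. Hence everything
  restricts to the graph. With \<open>W x = w (x, G x)\<close>, two identities hold there:

  \<^item> \<open>div (\<Sigma> \<nabla>\<phi>) (x, G x) = div W x\<close> (lemma \<open>divergence_on_graph\<close>): the \<open>y\<close>-part of the divergence
    is the trace of \<open>M\<^sup>T D\<^sub>yw\<close>, and the chain rule for \<open>W\<close> contributes the trace of
    \<open>D\<^sub>yw M\<^sup>T\<close>, which is the same number.

  \<^item> \<open>\<nabla>\<phi> \<bullet> A = W \<bullet> \<nabla>V\<close>: since \<open>\<nabla>f\<^sup>*\<close> inverts \<open>\<nabla>f\<close>, the \<open>\<lambda>\<close>-term of the drift vanishes on the graph and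
    what remains of \<open>A\<close> is \<open>(\<nabla>V, M\<^sup>T \<nabla>V)\<close>.

  The right-hand side of the Fokker-Planck equation is therefore
  \<open>\<integral> (div W - W \<bullet> \<nabla>V) e\<^sup>-\<^sup>V dx\<close> up to normalisation, which is the integral of
  \<open>div (e\<^sup>-\<^sup>V W)\<close>, a divergence of a compactly supported \<open>C\<^sup>1\<close> field, and so it is zero
  (\<open>integration_by_parts_Gibbs\<close>). The rest is regularity: \<open>C\<^sup>3\<close> for \<open>f\<close> is what makes \<open>M\<close>, and with it
  \<open>w\<close> and \<open>W\<close>, continuously differentiable, and measurability of the drift off the graph comes from
  writing \<open>\<nabla>f\<^sup>*\<close> as a limit of difference quotients.
\<close>

section \<open>Continuously differentiable maps\<close>

text \<open>
  The class \<open>C\<^sup>1\<close> for vector-valued maps, with continuity of the derivative tested direction by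
  direction as in \<^const>\<open>Ck\<close>, so that both agree on real-valued functions.
\<close>
definition C1_map :: "('a::euclidean_space \<Rightarrow> 'b::euclidean_space) \<Rightarrow> bool" where
  "C1_map F \<longleftrightarrow> (\<forall>x. F differentiable (at x)) \<and>
     (\<forall>v. continuous_on UNIV (\<lambda>x. frechet_derivative F (at x) v))"

lemma C1_mapI:
  assumes "\<And>x. (F has_derivative F' x) (at x)"
    and "\<And>v. continuous_on UNIV (\<lambda>x. F' x v)"
  shows "C1_map F"
proof -
  have "frechet_derivative F (at x) = F' x" for x
    using frechet_derivative_at[OF assms(1)] by simp
  then show ?thesis
    using assms by (auto simp: C1_map_def differentiable_def)
qed

lemma C1_map_has_derivative:
  "C1_map F \<Longrightarrow> (F has_derivative frechet_derivative F (at x)) (at x)"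
  by (simp add: C1_map_def flip: frechet_derivative_works)

lemma C1_map_continuous_derivative:
  "C1_map F \<Longrightarrow> continuous_on UNIV (\<lambda>x. frechet_derivative F (at x) v)"
  by (simp add: C1_map_def)

lemma C1_map_continuous: "C1_map F \<Longrightarrow> continuous_on UNIV F"
  by (simp add: C1_map_def continuous_at_imp_continuous_on differentiable_imp_continuous_within)

lemma linear_Basis_expansion:
  fixes L :: "'a::euclidean_space \<Rightarrow> 'b::real_vector"
  assumes "linear L"
  shows "L v = (\<Sum>b\<in>Basis. (v \<bullet> b) *\<^sub>R L b)"
proof -
  have "L v = L (\<Sum>b\<in>Basis. (v \<bullet> b) *\<^sub>R b)" by (simp add: euclidean_representation)
  then show ?thesis by (simp add: linear_sum[OF assms] linear_scale[OF assms])
qed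

text \<open>
  Joint continuity in base point and direction: by linearity a general direction is a combination of
  the finitely many basis directions. The chain rule needs this form.
\<close>
lemma continuous_on_C1_derivative:
  assumes "C1_map F" "continuous_on S p" "continuous_on S u"
  shows "continuous_on S (\<lambda>x. frechet_derivative F (at (p x)) (u x))"
proof -
  have "frechet_derivative F (at (p x)) (u x) =
      (\<Sum>b\<in>Basis. (u x \<bullet> b) *\<^sub>R frechet_derivative F (at (p x)) b)" for x
    by (rule linear_Basis_expansion[OF has_derivative_linear[OF C1_map_has_derivative[OF assms(1)]]])
  moreover have "continuous_on S (\<lambda>x. frechet_derivative F (at (p x)) b)" for b
    using continuous_on_compose2[OF C1_map_continuous_derivative[OF assms(1)] assms(2)] by simp
  ultimately show ?thesis
    using assms(3) by (auto intro!: continuous_intros)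
qed

lemma C1_map_linear: "linear L \<Longrightarrow> C1_map L"
  by (rule C1_mapI[where F' = "\<lambda>_. L"])
    (auto intro: bounded_linear_imp_has_derivative simp: linear_conv_bounded_linear)

lemma C1_map_compose:
  assumes "C1_map F" "C1_map p"
  shows "C1_map (\<lambda>x. F (p x))"
proof (rule C1_mapI)
  show "((\<lambda>x. F (p x)) has_derivative
      (\<lambda>v. frechet_derivative F (at (p x)) (frechet_derivative p (at x) v))) (at x)" for x
    by (rule has_derivative_compose[OF C1_map_has_derivative[OF assms(2)]
          C1_map_has_derivative[OF assms(1)]])
qed (intro continuous_on_C1_derivative C1_map_continuous C1_map_continuous_derivative assms)

lemma C1_map_add:
  assumes "C1_map F" "C1_map G"
  shows "C1_map (\<lambda>x. F x + G x)"
  by (rule C1_mapI[OF has_derivative_add[OF assms[THEN C1_map_has_derivative]]])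
    (intro continuous_intros C1_map_continuous_derivative assms)

lemma C1_map_bilinear:
  assumes "bounded_bilinear B" "C1_map F" "C1_map G"
  shows "C1_map (\<lambda>x. B (F x) (G x))"
  by (rule C1_mapI[OF bounded_bilinear.FDERIV[OF assms(1) assms(2,3)[THEN C1_map_has_derivative]]])
    (intro continuous_intros bounded_bilinear.continuous_on[OF assms(1)]
      C1_map_continuous_derivative C1_map_continuous assms(2,3))

lemma C1_map_componentwise:
  assumes "\<And>b. b \<in> Basis \<Longrightarrow> C1_map (\<lambda>x. F x \<bullet> b)"
  shows "C1_map F"
proof (rule C1_mapI)
  let ?F' = "\<lambda>x v. \<Sum>b\<in>Basis. frechet_derivative (\<lambda>x. F x \<bullet> b) (at x) v *\<^sub>R b"
  show "(F has_derivative ?F' x) (at x)" for x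
    using assms[THEN C1_map_has_derivative]
    by (subst has_derivative_componentwise_within) (auto simp: inner_sum_left inner_Basis if_distrib cong: if_cong)
  show "continuous_on UNIV (\<lambda>x. ?F' x v)" for v
    by (intro continuous_intros assms[THEN C1_map_continuous_derivative]) 
qed

lemma C1_map_Pair:
  assumes "C1_map F" "C1_map G"
  shows "C1_map (\<lambda>x. (F x, G x))"
  by (rule C1_mapI[OF has_derivative_Pair[OF assms[THEN C1_map_has_derivative]]])
    (intro continuous_intros C1_map_continuous_derivative assms)

lemma Ck_1_iff_C1_map: "Ck 1 u \<longleftrightarrow> C1_map u"
  by (simp add: C1_map_def)

lemma Ck_Suc_imp_Ck: "Ck (Suc k) u \<Longrightarrow> Ck k u"
proof (induction k arbitrary: u)
  case 0
  then show ?case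
    by (auto intro!: differentiable_imp_continuous_within continuous_at_imp_continuous_on)
next
  case (Suc k)
  then show ?case by simp
qed

lemma grad_inner:
  assumes "u differentiable (at x)"
  shows "grad u x \<bullet> v = frechet_derivative u (at x) v"
proof -
  have "(u has_derivative (\<lambda>h. h \<bullet> grad u x)) (at x)"
    using differentiable_imp_gderiv_grad[OF assms] by (simp add: gderiv_def)
  then show ?thesis by (metis frechet_derivative_at inner_commute)
qed

lemma C1_map_grad:
  assumes "Ck 2 u"
  shows "C1_map (grad u)"
proof (rule C1_map_componentwise)
  fix b
  have "(\<lambda>x. grad u x \<bullet> b) = (\<lambda>x. frechet_derivative u (at x) b)"
    using assms by (simp add: grad_inner numeral_2_eq_2)
  then show "C1_map (\<lambda>x. grad u x \<bullet> b)"
    using assms by (simp add: numeral_2_eq_2 flip: Ck_1_iff_C1_map)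
qed

section \<open>Symmetry of the second derivative\<close>

lemma has_real_derivative_along_line:
  fixes u :: "'a::euclidean_space \<Rightarrow> real"
  assumes "u differentiable (at (y + s *\<^sub>R c))"
  shows "((\<lambda>s. u (y + s *\<^sub>R c)) has_real_derivative frechet_derivative u (at (y + s *\<^sub>R c)) c) (at s)"
proof -
  let ?D = "frechet_derivative u (at (y + s *\<^sub>R c))"
  have u: "(u has_derivative ?D) (at (y + s *\<^sub>R c))"
    using assms by (simp add: frechet_derivative_works)
  have "((\<lambda>s. y + s *\<^sub>R c) has_derivative (\<lambda>r. r *\<^sub>R c)) (at s)"
    by (auto intro!: derivative_eq_intros)
  from has_derivative_compose[OF this, of u ?D] u
  have "((\<lambda>s. u (y + s *\<^sub>R c)) has_derivative (\<lambda>r. ?D (r *\<^sub>R c))) (at s)" by blast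
  then show ?thesis
    by (simp add: has_field_derivative_def linear_scale[OF has_derivative_linear[OF u]] mult_commute_abs)
qed

text \<open>
  The mean value theorem, first along \<open>a\<close> for \<open>y \<mapsto> u (y + t b) - u y\<close> and then along \<open>b\<close> for the
  derivative of \<open>u\<close> in direction \<open>a\<close>. The left-hand side is symmetric in \<open>a\<close> and \<open>b\<close>, the right-hand
  side is not visibly so; this is the source of Schwarz's theorem.
\<close>
lemma second_difference_mean_value:
  fixes u :: "'a::euclidean_space \<Rightarrow> real"
  assumes u: "\<And>x. u differentiable (at x)"
    and ua: "\<And>x. (\<lambda>x. frechet_derivative u (at x) a) differentiable (at x)"
    and "0 < t"
  obtains p q where "0 < p" "p < t" "0 < q" "q < t"
    "u (x + t *\<^sub>R a + t *\<^sub>R b) - u (x + t *\<^sub>R a) - u (x + t *\<^sub>R b) + u x =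
     t\<^sup>2 * frechet_derivative (\<lambda>x. frechet_derivative u (at x) a) (at (x + p *\<^sub>R a + q *\<^sub>R b)) b"
proof -
  let ?A = "\<lambda>x. frechet_derivative u (at x) a"
  have "\<exists>p>0. p < t \<and> (u (x + t *\<^sub>R b + t *\<^sub>R a) - u (x + t *\<^sub>R a)) - (u (x + t *\<^sub>R b + 0 *\<^sub>R a) - u (x + 0 *\<^sub>R a))
      = (t - 0) * (?A (x + t *\<^sub>R b + p *\<^sub>R a) - ?A (x + p *\<^sub>R a))"
    by (rule MVT2[OF \<open>0 < t\<close>]) (intro DERIV_diff has_real_derivative_along_line u)
  then obtain p where p: "0 < p" "p < t" and
    1: "(u (x + t *\<^sub>R b + t *\<^sub>R a) - u (x + t *\<^sub>R a)) - (u (x + t *\<^sub>R b + 0 *\<^sub>R a) - u (x + 0 *\<^sub>R a))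
      = (t - 0) * (?A (x + t *\<^sub>R b + p *\<^sub>R a) - ?A (x + p *\<^sub>R a))" by blast
  have "\<exists>q>0. q < t \<and> ?A ((x + p *\<^sub>R a) + t *\<^sub>R b) - ?A ((x + p *\<^sub>R a) + 0 *\<^sub>R b)
      = (t - 0) * frechet_derivative ?A (at ((x + p *\<^sub>R a) + q *\<^sub>R b)) b"
    by (rule MVT2[OF \<open>0 < t\<close>]) (intro has_real_derivative_along_line ua)
  then obtain q where q: "0 < q" "q < t" and
    2: "?A ((x + p *\<^sub>R a) + t *\<^sub>R b) - ?A ((x + p *\<^sub>R a) + 0 *\<^sub>R b)
      = (t - 0) * frechet_derivative ?A (at ((x + p *\<^sub>R a) + q *\<^sub>R b)) b" by blast
  show thesis
    by (rule that[OF p q]) (use 1 2 in \<open>simp add: power2_eq_square algebra_simps\<close>)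
qed

text \<open>
  Schwarz's theorem: the symmetric second difference, divided by \<open>t\<^sup>2\<close>, tends to both mixed
  derivatives as \<open>t\<close> goes to 0.
\<close>
lemma second_derivative_symmetric:
  fixes u :: "'a::euclidean_space \<Rightarrow> real"
  assumes u: "Ck 2 u"
  shows "frechet_derivative (\<lambda>x. frechet_derivative u (at x) a) (at x) b =
         frechet_derivative (\<lambda>x. frechet_derivative u (at x) b) (at x) a"
proof -
  define D where "D a b x = frechet_derivative (\<lambda>x. frechet_derivative u (at x) a) (at x) b" for a b x
  define d where "d a b t = u (x + t *\<^sub>R a + t *\<^sub>R b) - u (x + t *\<^sub>R a) - u (x + t *\<^sub>R b) + u x" for a b t
  define t where "t n = inverse (real (Suc n))" for n
  have t: "t \<longlonglongrightarrow> 0" "t n > 0" for n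
    unfolding t_def by (rule LIMSEQ_inverse_real_of_nat) simp
  have lim: "(\<lambda>n. d a b (t n) / (t n)\<^sup>2) \<longlonglongrightarrow> D a b x" for a b
  proof -
    have "\<exists>p q. 0 < p \<and> p < t n \<and> 0 < q \<and> q < t n \<and>
        d a b (t n) = (t n)\<^sup>2 * D a b (x + p *\<^sub>R a + q *\<^sub>R b)" for n
    proof -
      have "\<And>x. u differentiable (at x)" "\<And>x. (\<lambda>x. frechet_derivative u (at x) a) differentiable (at x)"
        using u by (simp_all add: numeral_2_eq_2)
      from second_difference_mean_value[OF this t(2)] show ?thesis
        unfolding d_def D_def by metis
    qed
    then obtain p q where pq: "\<And>n. 0 < p n" "\<And>n. p n < t n" "\<And>n. 0 < q n" "\<And>n. q n < t n"
        "\<And>n. d a b (t n) = (t n)\<^sup>2 * D a b (x + p n *\<^sub>R a + q n *\<^sub>R b)" by metis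
    have "p \<longlonglongrightarrow> 0" "q \<longlonglongrightarrow> 0"
      using pq(1-4) by (auto intro!: tendsto_sandwich[OF _ _ tendsto_const t(1)] always_eventually less_imp_le)
    then have "(\<lambda>n. x + p n *\<^sub>R a + q n *\<^sub>R b) \<longlonglongrightarrow> x + 0 *\<^sub>R a + 0 *\<^sub>R b"
      by (intro tendsto_intros)
    moreover have "isCont (D a b) x"
      using u unfolding D_def[abs_def] by (simp add: numeral_2_eq_2 continuous_on_eq_continuous_at)
    ultimately have "(\<lambda>n. D a b (x + p n *\<^sub>R a + q n *\<^sub>R b)) \<longlonglongrightarrow> D a b x"
      by (auto intro: isCont_tendsto_compose)
    then show ?thesis using t(2) by (simp add: pq(5) less_imp_neq[symmetric])
  qed
  have "d a b = d b a" by (auto simp: d_def algebra_simps)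
  then have "D a b x = D b a x" using lim[of a b] lim[of b a] LIMSEQ_unique by metis
  then show ?thesis by (simp add: D_def)
qed

section \<open>Integration by parts on Euclidean space\<close>

lemma difference_quotient_LIMSEQ:
  fixes u :: "'a::euclidean_space \<Rightarrow> real"
  assumes "u differentiable (at x)"
  shows "(\<lambda>n. real (Suc n) * (u (x + inverse (real (Suc n)) *\<^sub>R v) - u x))
    \<longlonglongrightarrow> frechet_derivative u (at x) v"
proof -
  have "((\<lambda>s. u (x + s *\<^sub>R v)) has_real_derivative frechet_derivative u (at x) v) (at 0)"
    using has_real_derivative_along_line[of u x 0 v] assms by simp
  then have "((\<lambda>h. (u (x + h *\<^sub>R v) - u x) / h) \<longlongrightarrow> frechet_derivative u (at x) v) (at 0)"
    by (simp add: DERIV_def)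
  moreover have "filterlim (\<lambda>n. inverse (real (Suc n))) (at 0) sequentially"
    by (rule filterlim_atI[OF LIMSEQ_inverse_real_of_nat]) simp
  ultimately show ?thesis
    by (rule filterlim_compose[THEN filterlim_cong[THEN iffD1, rotated 3]])
      (auto simp: field_simps)
qed

text \<open>
  The derivative is a pointwise limit of difference quotients, hence measurable even where it is
  not continuous. Applied to the conjugate, whose gradient is assumed to exist but not to be
  continuous, it makes the drift a measurable function.
\<close>
lemma borel_measurable_frechet_derivative:
  fixes u :: "'a::euclidean_space \<Rightarrow> real"
  assumes "\<And>x. u differentiable (at x)"
  shows "(\<lambda>x. frechet_derivative u (at x) v) \<in> borel_measurable borel"
proof (rule borel_measurable_LIMSEQ_real[OF difference_quotient_LIMSEQ[OF assms]])
  have [measurable]: "u \<in> borel_measurable borel"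
    using assms by (intro borel_measurable_continuous_onI continuous_at_imp_continuous_on
        ballI differentiable_imp_continuous_within)
  show "(\<lambda>x. real (Suc n) * (u (x + inverse (real (Suc n)) *\<^sub>R v) - u x)) \<in> borel_measurable borel" for n
    by measurable
qed

lemma frechet_derivative_inner_left:
  assumes "F differentiable (at x)"
  shows "frechet_derivative (\<lambda>x. F x \<bullet> b) (at x) v = frechet_derivative F (at x) v \<bullet> b"
proof -
  have "((\<lambda>x. F x \<bullet> b) has_derivative (\<lambda>v. frechet_derivative F (at x) v \<bullet> b)) (at x)"
    using assms by (intro has_derivative_inner_left) (simp add: frechet_derivative_works)
  from frechet_derivative_at[OF this, symmetric] show ?thesis by (rule fun_cong)
qed

lemma borel_measurable_grad:
  fixes u :: "'a::euclidean_space \<Rightarrow> real"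
  assumes "\<And>x. u differentiable (at x)"
  shows "grad u \<in> borel_measurable borel"
  by (subst borel_measurable_euclidean_space)
    (simp add: grad_inner assms borel_measurable_frechet_derivative)

lemma integrable_compact_support:
  fixes h :: "'a::euclidean_space \<Rightarrow> real"
  assumes "continuous_on UNIV h" and "\<And>x. norm x > R \<Longrightarrow> h x = 0"
  shows "integrable lborel h"
proof -
  have "integrable lborel (\<lambda>x. indicator (cball 0 R) x *\<^sub>R h x)"
    by (rule borel_integrable_compact) (auto intro: continuous_on_subset[OF assms(1)])
  moreover have "(\<lambda>x. indicator (cball 0 R) x *\<^sub>R h x) = h"
    using assms(2) by (auto simp: fun_eq_iff indicator_def not_le)
  ultimately show ?thesis by simp
qed

lemma integral_lborel_translate:
  fixes h :: "'a::euclidean_space \<Rightarrow> real"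
  assumes "h \<in> borel_measurable borel"
  shows "(\<integral>x. h (x + c) \<partial>lborel) = (\<integral>x. h x \<partial>lborel)"
    and "integrable lborel (\<lambda>x. h (x + c)) \<longleftrightarrow> integrable lborel h"
proof -
  have "distr lborel borel (\<lambda>x. x + c) = (lborel :: 'a measure)"
    using lborel_distr_plus[of c] by (subst (asm) add.commute[abs_def])
  then show "(\<integral>x. h (x + c) \<partial>lborel) = (\<integral>x. h x \<partial>lborel)"
      "integrable lborel (\<lambda>x. h (x + c)) \<longleftrightarrow> integrable lborel h"
    using integral_distr[of "\<lambda>x. x + c" lborel borel h]
      integrable_distr_eq[of "\<lambda>x. x + c" lborel borel h] assms by simp_all
qed

lemma frechet_derivative_zero_outside:
  fixes F :: "'a::euclidean_space \<Rightarrow> 'b::euclidean_space"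
  assumes "\<And>x. norm x > R \<Longrightarrow> F x = 0" and "norm x > R"
  shows "frechet_derivative F (at x) v = 0"
proof -
  have "open {x::'a. norm x > R}" by (intro open_Collect_less continuous_intros)
  then have "(F has_derivative (\<lambda>_. 0)) (at x)"
    by (rule has_derivative_transform_within_open[OF has_derivative_const]) (use assms in auto)
  from frechet_derivative_at[OF this, symmetric] show ?thesis by (rule fun_cong)
qed

text \<open>
  The integrals of \<open>u\<close> and of its translates agree, so every difference quotient has integral 0.
  The quotients are bounded by the supremum of the directional derivative on a fixed ball, and
  dominated convergence passes to the limit.
\<close>
lemma integral_derivative_compact_support:
  fixes u :: "'a::euclidean_space \<Rightarrow> real"
  assumes u: "C1_map u" and supp: "\<And>x. norm x > R \<Longrightarrow> u x = 0"
  shows "(\<integral>x. frechet_derivative u (at x) v \<partial>lborel) = 0"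
proof -
  have diff: "u differentiable (at x)" for x using u by (simp add: C1_map_def)
  have cont: "continuous_on UNIV u" by (rule C1_map_continuous[OF u])
  then have meas[measurable]: "u \<in> borel_measurable borel" by (rule borel_measurable_continuous_onI)
  have int_u: "integrable lborel u" by (rule integrable_compact_support[OF cont supp])
  have "compact ((\<lambda>x. frechet_derivative u (at x) v) ` cball 0 R)"
    by (intro compact_continuous_image continuous_on_subset[OF C1_map_continuous_derivative[OF u]]) auto
  then obtain B where B: "B > 0" "\<And>x. x \<in> cball 0 R \<Longrightarrow> \<bar>frechet_derivative u (at x) v\<bar> \<le> B"
    unfolding compact_eq_bounded_closed bounded_pos by auto
  have B': "\<bar>frechet_derivative u (at x) v\<bar> \<le> B" for x
    using B frechet_derivative_zero_outside[of R u x v] supp by (cases "norm x \<le> R") auto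
  have lip: "\<bar>u (x + s *\<^sub>R v) - u x\<bar> \<le> s * B" if "s > 0" for x s
  proof -
    have "\<exists>r>0. r < s \<and> u (x + s *\<^sub>R v) - u (x + 0 *\<^sub>R v) = (s - 0) * frechet_derivative u (at (x + r *\<^sub>R v)) v"
      by (rule MVT2[OF that has_real_derivative_along_line[OF diff]])
    then show ?thesis using that B' by (auto simp: abs_mult)
  qed
  define t where "t n = inverse (real (Suc n))" for n
  have t: "t n > 0" "t n \<le> 1" for n unfolding t_def by (auto simp: field_simps)
  let ?q = "\<lambda>n x. real (Suc n) * (u (x + t n *\<^sub>R v) - u x)"
  \<comment> \<open>The steps are at most \<open>1\<close>, so the translated supports stay inside this ball.\<close>
  let ?w = "\<lambda>x. B * indicator (cball 0 (R + norm v)) x :: real"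
  have "(\<lambda>n. \<integral>x. ?q n x \<partial>lborel) \<longlonglongrightarrow> (\<integral>x. frechet_derivative u (at x) v \<partial>lborel)"
  proof (rule integral_dominated_convergence)
    show "(\<lambda>x. frechet_derivative u (at x) v) \<in> borel_measurable lborel"
      using borel_measurable_frechet_derivative[OF diff] by simp
    show "?q n \<in> borel_measurable lborel" for n by measurable
    show "integrable lborel ?w"
      by (intro integrable_mult_right integrable_real_indicator emeasure_compact_finite)
        (auto simp: emeasure_compact_finite)
    show "AE x in lborel. (\<lambda>n. ?q n x) \<longlonglongrightarrow> frechet_derivative u (at x) v"
      unfolding t_def by (intro AE_I2 difference_quotient_LIMSEQ diff)
    have "norm (?q n x) \<le> ?w x" for n x
    proof (cases "norm x \<le> R + norm v")
      case True
      have "real (Suc n) * \<bar>u (x + t n *\<^sub>R v) - u x\<bar> \<le> real (Suc n) * (t n * B)"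
        by (intro mult_left_mono lip t) simp
      also have "\<dots> = B" by (simp add: t_def)
      finally show ?thesis using True by (simp add: abs_mult)
    next
      case False
      have "norm (t n *\<^sub>R v) \<le> norm v" using t[of n] by (simp add: mult_left_le_one_le)
      then have "norm (x + t n *\<^sub>R v) > R"
        using False norm_diff_ineq[of x "t n *\<^sub>R v"] by linarith
      moreover have "norm x > R" using False norm_ge_zero[of v] by linarith
      ultimately show ?thesis using False by (simp add: supp)
    qed
    then show "AE x in lborel. norm (?q n x) \<le> ?w x" for n by simp
  qed
  moreover have "(\<integral>x. ?q n x \<partial>lborel) = 0" for n
    using int_u by (simp add: integral_lborel_translate Bochner_Integration.integral_diff)
  ultimately show ?thesis by (simp add: LIMSEQ_const_iff)
qed

lemma continuous_on_divergence: "C1_map F \<Longrightarrow> continuous_on UNIV (divergence F)"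
  unfolding divergence_def[abs_def] by (intro continuous_intros C1_map_continuous_derivative)

lemma divergence_zero_outside:
  "(\<And>x. norm x > R \<Longrightarrow> F x = 0) \<Longrightarrow> norm x > R \<Longrightarrow> divergence F x = 0"
  by (simp add: divergence_def frechet_derivative_zero_outside[of R F])

lemma integral_divergence_compact_support:
  assumes F: "C1_map F" and supp: "\<And>x. norm x > R \<Longrightarrow> F x = 0"
  shows "(\<integral>x. divergence F x \<partial>lborel) = 0"
proof -
  have Fb: "C1_map (\<lambda>x. F x \<bullet> b)" for b
    by (rule C1_map_compose[OF C1_map_linear F]) (auto intro!: linearI simp: inner_add_left)
  have "divergence F x = (\<Sum>b\<in>Basis. frechet_derivative (\<lambda>x. F x \<bullet> b) (at x) b)" for x
    using F by (simp add: divergence_def C1_map_def frechet_derivative_inner_left)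
  moreover have "integrable lborel (\<lambda>x. frechet_derivative (\<lambda>x. F x \<bullet> b) (at x) b)" for b
    by (rule integrable_compact_support[of _ R])
      (auto intro!: C1_map_continuous_derivative[OF Fb] frechet_derivative_zero_outside[of R] simp: supp)
  moreover have "(\<integral>x. frechet_derivative (\<lambda>x. F x \<bullet> b) (at x) b \<partial>lborel) = 0" for b
    by (rule integral_derivative_compact_support[OF Fb, of R]) (simp add: supp)
  ultimately show ?thesis by simp
qed

text \<open>
  The product rule gives \<open>div (e\<^sup>-\<^sup>V W) = e\<^sup>-\<^sup>V (div W - W \<bullet> \<nabla>V)\<close>, and the left-hand side integrates to
  zero. This is the invariance of the Gibbs measure under overdamped Langevin dynamics.
\<close>
lemma integration_by_parts_Gibbs:
  fixes W :: "'a::euclidean_space \<Rightarrow> 'a"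
  assumes V: "C1_map V" and W: "C1_map W" and supp: "\<And>x. norm x > R \<Longrightarrow> W x = 0"
  shows "integrable lborel (\<lambda>x. exp (- V x) * divergence W x)"
    and "integrable lborel (\<lambda>x. exp (- V x) * (W x \<bullet> grad V x))"
    and "(\<integral>x. exp (- V x) * divergence W x \<partial>lborel) = (\<integral>x. exp (- V x) * (W x \<bullet> grad V x) \<partial>lborel)"
proof -
  have V': "(V has_derivative (\<lambda>v. grad V x \<bullet> v)) (at x)" for x
    using C1_map_has_derivative[OF V, of x] V by (simp add: grad_inner C1_map_def)
  have contV: "continuous_on UNIV (\<lambda>x. exp (- V x))"
    by (intro continuous_intros C1_map_continuous[OF V])
  have "continuous_on UNIV (\<lambda>x. grad V x \<bullet> v)" for v
    using V by (simp add: grad_inner C1_map_def)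
  then have contgV: "continuous_on UNIV (grad V)"
    by (rule continuous_on_componentwise[THEN iffD2, OF ballI])
  show 1: "integrable lborel (\<lambda>x. exp (- V x) * divergence W x)"
    by (rule integrable_compact_support[of _ R])
      (auto intro!: continuous_intros contV continuous_on_divergence[OF W] divergence_zero_outside simp: supp)
  show 2: "integrable lborel (\<lambda>x. exp (- V x) * (W x \<bullet> grad V x))"
    by (rule integrable_compact_support[of _ R])
      (auto intro!: continuous_intros contV contgV C1_map_continuous[OF W] simp: supp)
  let ?X = "\<lambda>x. exp (- V x) *\<^sub>R W x"
  have E': "((\<lambda>x. exp (- V x)) has_derivative (\<lambda>v. - exp (- V x) * (grad V x \<bullet> v))) (at x)" for x
    by (auto intro!: derivative_eq_intros V')
  have "C1_map (\<lambda>x. exp (- V x))"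
    by (rule C1_mapI[OF E']) (intro continuous_intros contV contgV)
  then have X: "C1_map ?X" by (rule C1_map_bilinear[OF bounded_bilinear_scaleR _ W])
  have X': "frechet_derivative ?X (at x) v =
      exp (- V x) *\<^sub>R frechet_derivative W (at x) v - (exp (- V x) * (grad V x \<bullet> v)) *\<^sub>R W x" for x v
  proof -
    have "frechet_derivative ?X (at x) =
      (\<lambda>v. exp (- V x) *\<^sub>R frechet_derivative W (at x) v + (- exp (- V x) * (grad V x \<bullet> v)) *\<^sub>R W x)"
      by (rule frechet_derivative_at[OF has_derivative_scaleR[OF E' C1_map_has_derivative[OF W]], symmetric])
    then show ?thesis by simp
  qed
  have "divergence ?X x = exp (- V x) * divergence W x - exp (- V x) * (W x \<bullet> grad V x)" for x
    unfolding divergence_def X' euclidean_inner[of "W x" "grad V x"]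
    by (simp add: inner_diff_left sum_subtractf sum_distrib_left mult_ac)
  then have "(\<integral>x. exp (- V x) * divergence W x - exp (- V x) * (W x \<bullet> grad V x) \<partial>lborel) = 0"
    using integral_divergence_compact_support[OF X, of R] supp by simp
  then show "(\<integral>x. exp (- V x) * divergence W x \<partial>lborel) = (\<integral>x. exp (- V x) * (W x \<bullet> grad V x) \<partial>lborel)"
    using 1 2 by simp
qed

section \<open>Restricting a divergence to a graph\<close>

text \<open>
  The identity \<open>tr (L T) = tr (T L)\<close> for \<open>T\<close> with adjoint \<open>S\<close>; the two traces are over different spaces.
\<close>
lemma trace_commute_adjoint:
  fixes L :: "'b::euclidean_space \<Rightarrow> 'a::euclidean_space"
  assumes "linear L" and adj: "\<And>u v. T u \<bullet> v = u \<bullet> S v"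
  shows "(\<Sum>i\<in>Basis. L (T i) \<bullet> i) = (\<Sum>j\<in>Basis. L j \<bullet> S j)"
proof -
  have "(\<Sum>i\<in>Basis. L (T i) \<bullet> i) = (\<Sum>i\<in>Basis. \<Sum>j\<in>Basis. (L j \<bullet> i) * (S j \<bullet> i))"
    by (subst linear_Basis_expansion[OF assms(1)])
      (simp add: adj inner_sum_left inner_commute[of "S _"] mult.commute)
  also have "\<dots> = (\<Sum>j\<in>Basis. L j \<bullet> S j)"
    by (subst sum.swap) (simp add: euclidean_inner[of "L _" "S _"])
  finally show ?thesis .
qed

lemma bounded_bilinear_transpose_matrix_vector:
  "bounded_bilinear (\<lambda>(A :: real^'m^'d) v. transpose A *v v)"
  unfolding bilinear_conv_bounded_bilinear[symmetric] bilinear_def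
  by (auto intro!: linearI simp del: transpose_matrix_vector
      simp: vec_eq_iff matrix_vector_mult_def transpose_def algebra_simps sum.distrib sum_distrib_left)

lemma bounded_bilinear_matrix_vector:
  "bounded_bilinear (\<lambda>(A :: real^'m^'d) v. A *v v)"
  unfolding bilinear_conv_bounded_bilinear[symmetric] bilinear_def
  by (auto intro!: linearI
      simp: vec_eq_iff matrix_vector_mult_def algebra_simps sum.distrib sum_distrib_left)

lemma inner_transpose_matrix_vector:
  fixes A :: "real^'m^'d"
  shows "(transpose A *v u) \<bullet> v = u \<bullet> (A *v v)"
  by (simp only: transpose_matrix_vector dot_lmul_matrix)

text \<open>
  The analogue of \<open>sum_Basis_prod_eq\<close>, which has summands in the product space itself, for real summands.
\<close>
lemma sum_Basis_prod:
  fixes h :: "'a::euclidean_space \<times> 'b::euclidean_space \<Rightarrow> real"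
  shows "sum h Basis = (\<Sum>i\<in>Basis. h (i, 0)) + (\<Sum>j\<in>Basis. h (0, j))"
proof -
  have "inj_on (\<lambda>u. (u::'a, 0::'b)) Basis" "inj_on (\<lambda>v. (0::'a, v::'b)) Basis"
    by (auto intro!: inj_onI)
  then show ?thesis
    unfolding Basis_prod_def by (subst sum.union_disjoint) (auto simp: sum.reindex)
qed

text \<open>
  The field \<open>(w, N\<^sup>T w)\<close> is tangent to the graph of \<open>G\<close> when \<open>N\<^sup>T\<close> is the Jacobian of \<open>G\<close>. Its second
  component involves \<open>N\<close> at the first coordinate only, so the derivative of \<open>N\<close> does not enter the
  divergence; the remaining \<open>y\<close>-trace is the term that the chain rule produces in \<open>w (x, G x)\<close>.
\<close>
lemma divergence_on_graph:
  fixes w :: "(real^'d) \<times> (real^'m) \<Rightarrow> real^'d" and N :: "real^'d \<Rightarrow> real^'m^'d"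
  assumes w: "C1_map w" and N: "C1_map N"
    and G: "\<And>x. (G has_derivative (\<lambda>u. transpose (N x) *v u)) (at x)"
  shows "divergence (\<lambda>z. (w z, transpose (N (fst z)) *v w z)) (x, G x) = divergence (\<lambda>x. w (x, G x)) x"
proof -
  let ?F = "\<lambda>z. (w z, transpose (N (fst z)) *v w z)"
  let ?w = "frechet_derivative w (at (x, G x))"
  let ?N = "frechet_derivative N (at x)"
  have w': "(w has_derivative ?w) (at (x, G x))" by (rule C1_map_has_derivative[OF w])
  have Nf: "((\<lambda>z. N (fst z)) has_derivative (\<lambda>u. ?N (fst u))) (at (x, G x))"
    using has_derivative_compose[OF has_derivative_fst[OF has_derivative_ident], of N ?N "(x, G x)" UNIV]
      C1_map_has_derivative[OF N, of x] by simp
  have F': "frechet_derivative ?F (at (x, G x)) =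
      (\<lambda>u. (?w u, transpose (N x) *v ?w u + transpose (?N (fst u)) *v w (x, G x)))"
    using frechet_derivative_at[OF has_derivative_Pair[OF w'
      bounded_bilinear.FDERIV[OF bounded_bilinear_transpose_matrix_vector Nf w']]] by simp
  have lin: "linear ?w" by (rule has_derivative_linear[OF w'])
  have "((\<lambda>x. w (x, G x)) has_derivative (\<lambda>u. ?w (u, transpose (N x) *v u))) (at x)"
    using has_derivative_compose[OF has_derivative_Pair[OF has_derivative_ident G] w'] .
  then have W': "frechet_derivative (\<lambda>x. w (x, G x)) (at x) = (\<lambda>u. ?w (u, transpose (N x) *v u))"
    by (rule frechet_derivative_at[symmetric])
  have N0: "?N 0 = 0" by (rule linear_0[OF has_derivative_linear[OF C1_map_has_derivative[OF N]]])
  have split: "?w (u, v) = ?w (u, 0) + ?w (0, v)" for u v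
    using linear_add[OF lin, of "(u, 0)" "(0, v)"] by simp
  have "divergence ?F (x, G x) =
      (\<Sum>i\<in>Basis. ?w (i, 0) \<bullet> i) + (\<Sum>j\<in>Basis. ?w (0, j) \<bullet> (N x *v j))"
    unfolding divergence_def F'
    by (subst sum_Basis_prod) (simp add: N0 inner_transpose_matrix_vector
        bounded_bilinear.zero_left[OF bounded_bilinear_transpose_matrix_vector]
        del: transpose_matrix_vector)
  also have "(\<Sum>j\<in>Basis. ?w (0, j) \<bullet> (N x *v j)) = (\<Sum>i\<in>Basis. ?w (0, transpose (N x) *v i) \<bullet> i)"
  proof (rule trace_commute_adjoint[symmetric])
    show "linear (\<lambda>v. ?w (0, v))"
    proof (rule linearI)
      show "?w (0, v + v') = ?w (0, v) + ?w (0, v')" for v v'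
        using linear_add[OF lin, of "(0, v)" "(0, v')"] by simp
      show "?w (0, r *\<^sub>R v) = r *\<^sub>R ?w (0, v)" for r v
        using linear_scale[OF lin, of r "(0, v)"] by simp
    qed
  qed (rule inner_transpose_matrix_vector)
  also have "(\<Sum>i\<in>Basis. ?w (i, 0) \<bullet> i) + \<dots> = divergence (\<lambda>x. w (x, G x)) x"
    unfolding divergence_def W' by (subst (3) split) (simp add: inner_add_left sum.distrib)
  finally show ?thesis .
qed

section \<open>The Hessian and the Jacobian of the dual map\<close>

lemma hessian_component:
  fixes f :: "real^'m \<Rightarrow> real"
  assumes f: "Ck 2 f"
  shows "hessian f x $ i $ j =
    frechet_derivative (\<lambda>x. frechet_derivative f (at x) (axis i 1)) (at x) (axis j 1)"
proof -
  have "(\<lambda>x. frechet_derivative f (at x) (axis i 1)) = (\<lambda>x. grad f x \<bullet> axis i 1)"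
    using f by (simp add: grad_inner numeral_2_eq_2)
  moreover have "frechet_derivative (\<lambda>x. grad f x \<bullet> axis i 1) (at x) (axis j 1) =
      frechet_derivative (grad f) (at x) (axis j 1) \<bullet> axis i 1"
    using C1_map_grad[OF f] by (intro frechet_derivative_inner_left) (simp add: C1_map_def)
  ultimately show ?thesis
    by (simp add: hessian_def matrix_def inner_axis)
qed

lemma transpose_hessian: "Ck 2 f \<Longrightarrow> transpose (hessian f x) = hessian f x"
  by (simp add: vec_eq_iff transpose_def hessian_component second_derivative_symmetric)

lemma C1_map_hessian:
  fixes f :: "real^'m \<Rightarrow> real"
  assumes f: "Ck 3 f"
  shows "C1_map (hessian f)"
proof (rule C1_map_componentwise)
  have f2: "Ck 2 f" using f Ck_Suc_imp_Ck[of 2 f] by simp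
  fix b :: "real^'m^'m" assume "b \<in> Basis"
  then obtain i j where b: "b = axis i (axis j 1)" by (auto simp: Basis_vec_def)
  have "(\<lambda>x. hessian f x \<bullet> b) =
      (\<lambda>x. frechet_derivative (\<lambda>x. frechet_derivative f (at x) (axis i 1)) (at x) (axis j 1))"
    by (simp add: b inner_axis hessian_component[OF f2])
  then show "C1_map (\<lambda>x. hessian f x \<bullet> b)"
    using f by (simp add: numeral_3_eq_3 flip: Ck_1_iff_C1_map)
qed

lemma grad_has_derivative_hessian:
  fixes f :: "real^'m \<Rightarrow> real"
  assumes "Ck 2 f"
  shows "(grad f has_derivative (\<lambda>v. hessian f x *v v)) (at x)"
  using C1_map_has_derivative[OF C1_map_grad[OF assms], of x]
  by (simp add: hessian_def matrix_works has_derivative_linear)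

lemma C1_map_M_mat:
  fixes f :: "real^'m \<Rightarrow> real" and K :: "real^'d^'m"
  assumes "Ck 3 f"
  shows "C1_map (M_mat f K)"
proof -
  have "linear (\<lambda>A::real^'m^'m. transpose K ** A)"
    by (auto intro!: linearI simp: matrix_add_ldistrib matrix_scalar_ac scalar_matrix_assoc
        vec_eq_iff matrix_matrix_mult_def algebra_simps sum_distrib_left sum.distrib)
  from C1_map_compose[OF C1_map_linear[OF this] C1_map_compose[OF C1_map_hessian[OF assms]
      C1_map_linear[OF matrix_vector_mul_linear[of K]]]]
  show ?thesis by (simp add: M_mat_def[abs_def])
qed

text \<open>
  The chain rule produces \<open>H\<^sub>f K\<close>, while \<open>M\<^sup>T = H\<^sub>f\<^sup>T K\<close>; symmetry of the Hessian reconciles them.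
\<close>
lemma dual_map_has_derivative:
  fixes f :: "real^'m \<Rightarrow> real" and K :: "real^'d^'m"
  assumes f: "Ck 2 f"
  shows "((\<lambda>x. grad f (K *v x)) has_derivative (\<lambda>u. transpose (M_mat f K x) *v u)) (at x)"
proof -
  have "transpose (M_mat f K x) *v u = hessian f (K *v x) *v (K *v u)" for u
    by (simp add: M_mat_def matrix_transpose_mul transpose_hessian[OF f] matrix_vector_mul_assoc
        del: transpose_matrix_vector)
  moreover have "((\<lambda>x. grad f (K *v x)) has_derivative (\<lambda>u. hessian f (K *v x) *v (K *v u))) (at x)"
    by (rule has_derivative_compose[OF bounded_linear_imp_has_derivative grad_has_derivative_hessian[OF f]]) simp
  ultimately show ?thesis by simp
qed

section \<open>The measure and the coefficients\<close>

text \<open>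
  Both blocks are images of the same vector, because the diffusion matrix factors through \<open>\<real>\<^sup>d\<close>.
\<close>
lemma Sigma_mod_factor:
  fixes f :: "real^'m \<Rightarrow> real" and K :: "real^'d^'m"
  shows "Sigma_mod f K z p = (fst p + M_mat f K (fst z) *v snd p,
    transpose (M_mat f K (fst z)) *v (fst p + M_mat f K (fst z) *v snd p))"
  using Sigma_mod_block[of f K "fst z" "snd z" "fst p" "snd p"]
  by (simp add: matrix_vector_right_distrib matrix_vector_mul_assoc del: transpose_matrix_vector)

text \<open>
  The graph is a null set of the product space, so \<open>\<pi>\<^sup>*\<close> has no density there; its integrals are
  pulled back along \<open>x \<mapsto> (x, G x)\<close> to \<open>\<mu>\<^sup>*\<close>, which has one.
\<close>
lemma
  fixes f :: "real^'m \<Rightarrow> real" and g :: "real^'d \<Rightarrow> real" and K :: "real^'d^'m"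
  defines "V \<equiv> \<lambda>x. f (K *v x) + g x"
  assumes V: "V \<in> borel_measurable borel"
    and G: "(\<lambda>x. grad f (K *v x)) \<in> borel_measurable borel"
    and pos: "0 < partition_function f g K" and fin: "partition_function f g K < \<infinity>"
  shows prob_space_pi_star: "prob_space (pi_star f g K)"
    and integrable_pi_star_iff: "h \<in> borel_measurable borel \<Longrightarrow>
      integrable (pi_star f g K) h \<longleftrightarrow> integrable lborel (\<lambda>x. exp (- V x) * h (x, grad f (K *v x)))"
    and integral_pi_star: "h \<in> borel_measurable borel \<Longrightarrow>
      (\<integral>z. h z \<partial>pi_star f g K) =
      (\<integral>x. exp (- V x) * h (x, grad f (K *v x)) \<partial>lborel) / enn2real (partition_function f g K)"
proof -
  let ?Z = "partition_function f g K"
  let ?r = "enn2real ?Z"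
  note [measurable] = V G
  have E: "exp (- f (K *v x) - g x) = exp (- V x)" for x by (simp add: V_def)
  have r: "?r > 0" "?Z = ennreal ?r"
    using pos fin by (auto simp: enn2real_positive_iff)
  have graph[measurable]: "(\<lambda>x. (x, grad f (K *v x))) \<in> borel_measurable borel"
    by (intro borel_measurable_Pair) (auto simp: G)
  have mu: "mu_star f g K = density lborel (\<lambda>x. ennreal (exp (- V x) / ?r))"
    unfolding mu_star_def E using r by (metis (no_types, lifting) divide_ennreal exp_ge_zero)
  have Z: "?Z = (\<integral>\<^sup>+x. ennreal (exp (- V x)) \<partial>lborel)"
    unfolding partition_function_def E ..
  have "emeasure (mu_star f g K) (space (mu_star f g K)) = (\<integral>\<^sup>+x. ennreal (exp (- V x)) / ?Z \<partial>lborel)"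
    unfolding mu_star_def E by (simp add: emeasure_density)
  also have "\<dots> = ?Z / ?Z"
    by (subst nn_integral_divide) (simp_all add: Z)
  also have "\<dots> = 1" using pos fin by (intro ennreal_divide_self) auto
  finally interpret mu: prob_space "mu_star f g K" by (rule prob_spaceI)
  have sets_mu[measurable_cong]: "sets (mu_star f g K) = sets borel" by (simp add: mu_star_def)
  show "prob_space (pi_star f g K)"
    unfolding pi_star_def by (rule mu.prob_space_distr) measurable
  {
    assume h[measurable]: "h \<in> borel_measurable borel"
    have hG[measurable]: "(\<lambda>x. h (x, grad f (K *v x))) \<in> borel_measurable borel"
      by (rule measurable_compose[OF graph h])
    have "integrable (pi_star f g K) h \<longleftrightarrow> integrable (mu_star f g K) (\<lambda>x. h (x, grad f (K *v x)))"
      unfolding pi_star_def by (rule integrable_distr_eq) measurable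
    also have "\<dots> \<longleftrightarrow> integrable lborel (\<lambda>x. (exp (- V x) / ?r) *\<^sub>R h (x, grad f (K *v x)))"
      unfolding mu by (rule integrable_density) (use r in auto)
    also have "\<dots> \<longleftrightarrow> integrable lborel (\<lambda>x. exp (- V x) * h (x, grad f (K *v x)))"
      using r integrable_mult_left_iff[of lborel "inverse ?r" "\<lambda>x. exp (- V x) * h (x, grad f (K *v x))"]
      by (simp add: divide_inverse mult_ac)
    finally show "integrable (pi_star f g K) h \<longleftrightarrow> integrable lborel (\<lambda>x. exp (- V x) * h (x, grad f (K *v x)))" .
    have "(\<integral>z. h z \<partial>pi_star f g K) = (\<integral>x. h (x, grad f (K *v x)) \<partial>mu_star f g K)"
      unfolding pi_star_def by (rule integral_distr) measurable
    also have "\<dots> = (\<integral>x. (exp (- V x) / ?r) *\<^sub>R h (x, grad f (K *v x)) \<partial>lborel)"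
      unfolding mu by (rule integral_density) (use r in auto)
    finally show "(\<integral>z. h z \<partial>pi_star f g K) =
      (\<integral>x. exp (- V x) * h (x, grad f (K *v x)) \<partial>lborel) / ?r"
      by simp
  }
qed

lemma test_function_grad_support:
  fixes \<phi> :: "'a::euclidean_space \<Rightarrow> real"
  assumes "test_function \<phi>"
  obtains R where "\<And>z. norm z > R \<Longrightarrow> grad \<phi> z = 0"
proof -
  have "bounded (closure {z. \<phi> z \<noteq> 0})"
    using assms by (simp add: test_function_def compact_imp_bounded)
  then obtain R where "\<And>z. z \<in> closure {z. \<phi> z \<noteq> 0} \<Longrightarrow> norm z \<le> R"
    by (auto simp: bounded_iff)
  then have R: "\<phi> z = 0" if "norm z > R" for z
    using that closure_subset[of "{z. \<phi> z \<noteq> 0}"] by force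
  have "Ck 1 \<phi>" using assms unfolding test_function_def by blast
  then have "\<phi> differentiable (at z)" for z by simp
  then have "grad \<phi> z \<bullet> b = 0" if "norm z > R" for z b
    using frechet_derivative_zero_outside[of R \<phi> z b, OF R that] by (simp add: grad_inner)
  then have "grad \<phi> z = 0" if "norm z > R" for z
    using that by (metis inner_eq_zero_iff)
  then show ?thesis by (rule that)
qed

lemma grad_potential:
  fixes f :: "real^'m \<Rightarrow> real" and g :: "real^'d \<Rightarrow> real" and K :: "real^'d^'m"
  assumes "f differentiable (at (K *v x))" "g differentiable (at x)"
  shows "grad (\<lambda>x. f (K *v x) + g x) x = grad g x + transpose K *v grad f (K *v x)"
proof (rule gderiv_imp_grad)
  have "(f has_derivative (\<lambda>h. h \<bullet> grad f (K *v x))) (at (K *v x))"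
    using differentiable_imp_gderiv_grad[OF assms(1)] by (simp add: gderiv_def)
  from has_derivative_compose[OF bounded_linear_imp_has_derivative[OF matrix_vector_mul_bounded_linear] this]
  have "((\<lambda>x. f (K *v x)) has_derivative (\<lambda>h. (K *v h) \<bullet> grad f (K *v x))) (at x)" .
  moreover have "(g has_derivative (\<lambda>h. h \<bullet> grad g x)) (at x)"
    using differentiable_imp_gderiv_grad[OF assms(2)] by (simp add: gderiv_def)
  ultimately have "((\<lambda>x. f (K *v x) + g x) has_derivative
      (\<lambda>h. (K *v h) \<bullet> grad f (K *v x) + h \<bullet> grad g x)) (at x)"
    by (rule has_derivative_add)
  moreover have "(K *v h) \<bullet> grad f (K *v x) = h \<bullet> (transpose K *v grad f (K *v x))" for h
    by (metis inner_transpose_matrix_vector transpose_transpose)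
  ultimately show "GDERIV (\<lambda>x. f (K *v x) + g x) x :> grad g x + transpose K *v grad f (K *v x)"
    by (simp add: gderiv_def inner_add_right add.commute del: transpose_matrix_vector)
qed

text \<open>
  All terms are continuous except possibly \<open>\<nabla>f\<^sup>*\<close>, which is a gradient and therefore measurable.
  Values off the graph matter here, since integrals against a push-forward are only transferred for
  functions measurable on the whole product space.
\<close>
lemma borel_measurable_A_mod:
  fixes f :: "real^'m \<Rightarrow> real" and g :: "real^'d \<Rightarrow> real" and K :: "real^'d^'m"
  assumes f: "Ck 3 f" and g: "Ck 1 g"
    and conj: "\<And>y. real_conjugate f differentiable (at y)"
  shows "A_mod f g K lam \<in> borel_measurable borel"
proof -
  have gf: "continuous_on UNIV (grad f)"
    using f Ck_Suc_imp_Ck[of 2 f] by (intro C1_map_continuous C1_map_grad) simp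
  have gg: "continuous_on UNIV (grad g)"
    by (rule continuous_on_componentwise[THEN iffD2, OF ballI]) (use g in \<open>simp add: grad_inner\<close>)
  have lin: "continuous_on UNIV (\<lambda>z. A *v u z)" if "continuous_on UNIV u"
    for A :: "real^'i^'j" and u :: "(real^'d) \<times> (real^'m) \<Rightarrow> real^'i"
    using that by (rule bounded_linear.continuous_on[OF matrix_vector_mul_bounded_linear])
  have gf': "continuous_on UNIV (\<lambda>z. grad f (u z))" if "continuous_on UNIV u" for u :: "(real^'d) \<times> (real^'m) \<Rightarrow> real^'m"
    by (rule continuous_on_compose2[OF gf that]) simp
  have gg': "continuous_on UNIV (\<lambda>z::(real^'d) \<times> (real^'m). grad g (fst z))"
    by (rule continuous_on_compose2[OF gg]) (auto intro: continuous_intros)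
  have M: "continuous_on UNIV (\<lambda>z::(real^'d) \<times> (real^'m). M_mat f K (fst z))"
    by (rule continuous_on_compose2[OF C1_map_continuous[OF C1_map_M_mat[OF f]]]) (auto intro: continuous_intros)
  have fst_snd: "continuous_on UNIV (fst :: (real^'d) \<times> (real^'m) \<Rightarrow> _)"
    "continuous_on UNIV (snd :: (real^'d) \<times> (real^'m) \<Rightarrow> _)"
    by (auto intro: continuous_intros)
  have 1: "continuous_on UNIV (\<lambda>z. grad g (fst z) + transpose K *v snd z)"
    by (intro continuous_on_add gg' lin fst_snd)
  have v: "continuous_on UNIV (\<lambda>z::(real^'d) \<times> (real^'m). grad g (fst z) + transpose K *v grad f (K *v fst z))"
    by (intro continuous_on_add gg' lin gf' fst_snd)
  have 2: "continuous_on UNIV (\<lambda>z::(real^'d) \<times> (real^'m). transpose (M_mat f K (fst z)) *v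
      (grad g (fst z) + transpose K *v grad f (K *v fst z)))"
    by (rule bounded_bilinear.continuous_on[OF bounded_bilinear_transpose_matrix_vector M v])
  have 3: "(\<lambda>z. grad (real_conjugate f) (snd z)) \<in> borel_measurable (borel :: ((real^'d) \<times> (real^'m)) measure)"
    by (rule measurable_compose[OF borel_measurable_continuous_onI[OF fst_snd(2)] borel_measurable_grad[OF conj]])
  show ?thesis
    unfolding A_mod_def[abs_def] Let_def
    by (intro borel_measurable_Pair borel_measurable_add borel_measurable_scaleR borel_measurable_diff
        borel_measurable_const borel_measurable_continuous_onI[OF 1] borel_measurable_continuous_onI[OF 2] 3
        borel_measurable_continuous_onI[OF lin[OF fst_snd(1)]])
qed

section \<open>Stationarity\<close>

theorem theorem3p13:
  fixes K :: "real^'d^'m"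
    and f :: "real^'m \<Rightarrow> real"
    and g :: "real^'d \<Rightarrow> real"
    and lam :: real
  assumes "convex_on UNIV f" and "convex_on UNIV g"
    and "Ck 3 f" and "Ck 1 g"
    and "0 < partition_function f g K" and "partition_function f g K < \<infinity>"
    and "\<forall>y. \<bar>convex_conjugate f y\<bar> \<noteq> \<infinity>"
    and "\<forall>y. real_conjugate f differentiable (at y)"
    and "bij (grad f)" and "grad (real_conjugate f) = inv (grad f)"
    and "lam > 0"
  shows "stationary_fp_solution (Sigma_mod f K) (A_mod f g K lam) (pi_star f g K) \<and>
    (\<forall>\<phi>. test_function \<phi> \<longrightarrow>
       fp_rhs (Sigma_mod f K) (A_mod f g K lam) (pi_star f g K) \<phi> = 0)"
proof -
  note f3 = \<open>Ck 3 f\<close>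
  let ?p = "pi_star f g K" and ?M = "M_mat f K" and ?A = "A_mod f g K lam"
  define V where "V x = f (K *v x) + g x" for x
  define G where "G x = grad f (K *v x)" for x
  have f2: "Ck 2 f" using f3 Ck_Suc_imp_Ck[of 2 f] by simp
  have f1: "Ck 1 f" using f2 Ck_Suc_imp_Ck[of 1 f] by (simp only: Suc_1)
  have fd: "f differentiable (at y)" and gd: "g differentiable (at x)" for x y
    using f1 \<open>Ck 1 g\<close> by simp_all
  have K: "C1_map (\<lambda>x. K *v x)" by (intro C1_map_linear matrix_vector_mul_linear)
  have V: "C1_map V"
    unfolding V_def[abs_def]
    by (intro C1_map_add C1_map_compose[OF _ K]) (use f1 \<open>Ck 1 g\<close> in \<open>simp_all only: Ck_1_iff_C1_map\<close>)
  have G: "C1_map G"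
    unfolding G_def[abs_def] by (intro C1_map_compose[OF _ K] C1_map_grad f2)
  have G': "(G has_derivative (\<lambda>u. transpose (?M x) *v u)) (at x)" for x
    unfolding G_def[abs_def] by (rule dual_map_has_derivative[OF f2])
  have gV: "grad V x = grad g x + transpose K *v G x" for x
    unfolding V_def[abs_def] G_def by (rule grad_potential[OF fd gd])
  have meas: "(\<lambda>x. f (K *v x) + g x) \<in> borel_measurable borel"
      "(\<lambda>x. grad f (K *v x)) \<in> borel_measurable borel"
    using V G unfolding V_def[abs_def] G_def[abs_def]
    by (auto intro: borel_measurable_continuous_onI C1_map_continuous)
  note pi_star = prob_space_pi_star[OF meas assms(5,6)]
    integrable_pi_star_iff[OF meas assms(5,6), folded V_def G_def]
    integral_pi_star[OF meas assms(5,6), folded V_def G_def]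

  have A_graph: "?A (x, G x) = (grad V x, transpose (?M x) *v grad V x)" for x
  proof -
    have "grad (real_conjugate f) (G x) = K *v x"
      unfolding G_def \<open>grad (real_conjugate f) = inv (grad f)\<close>
      by (rule inv_f_f[OF bij_is_inj[OF \<open>bij (grad f)\<close>]])
    then show ?thesis by (simp add: A_mod_def gV flip: G_def del: transpose_matrix_vector)
  qed

  have key: "integrable ?p (divergence (\<lambda>z. Sigma_mod f K z (grad \<phi> z))) \<and>
      integrable ?p (\<lambda>z. grad \<phi> z \<bullet> ?A z) \<and> fp_rhs (Sigma_mod f K) ?A ?p \<phi> = 0"
    if "test_function \<phi>" for \<phi>
  proof -
    have \<phi>: "C1_map (grad \<phi>)" using that by (intro C1_map_grad) (simp only: test_function_def)
    define w where "w z = fst (grad \<phi> z) + ?M (fst z) *v snd (grad \<phi> z)" for z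
    define W where "W x = w (x, G x)" for x
    let ?F = "\<lambda>z. Sigma_mod f K z (grad \<phi> z)"
    have F: "?F = (\<lambda>z. (w z, transpose (?M (fst z)) *v w z))"
      by (simp add: Sigma_mod_factor w_def del: transpose_matrix_vector)
    have fst_snd: "C1_map (fst :: (real^'d) \<times> (real^'m) \<Rightarrow> _)" "C1_map (snd :: (real^'d) \<times> (real^'m) \<Rightarrow> _)"
      by (auto intro!: C1_map_linear linearI)
    have M: "C1_map (\<lambda>z::(real^'d) \<times> (real^'m). ?M (fst z))"
      by (rule C1_map_compose[OF C1_map_M_mat[OF f3] fst_snd(1)])
    have w: "C1_map w"
      unfolding w_def[abs_def]
      by (intro C1_map_add C1_map_bilinear[OF bounded_bilinear_matrix_vector] M
          C1_map_compose[OF fst_snd(1) \<phi>] C1_map_compose[OF fst_snd(2) \<phi>])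
    have FC1: "C1_map ?F"
      unfolding F by (intro C1_map_Pair w C1_map_bilinear[OF bounded_bilinear_transpose_matrix_vector M w])
    have id: "C1_map (\<lambda>x::real^'d. x)" by (auto intro!: C1_map_linear linearI)
    have W: "C1_map W"
      unfolding W_def[abs_def] by (rule C1_map_compose[OF w C1_map_Pair[OF id G]])
    obtain R where R: "\<And>z. norm z > R \<Longrightarrow> grad \<phi> z = 0"
      using test_function_grad_support[OF \<open>test_function \<phi>\<close>] by blast
    have "W x = 0" if "norm x > R" for x
    proof -
      have "norm (x, G x) > R" using that norm_fst_le[of x "G x"] by simp
      then show ?thesis by (simp add: W_def w_def R)
    qed
    note parts = integration_by_parts_Gibbs[OF V W this]

    have div_graph: "divergence ?F (x, G x) = divergence W x" for x
      unfolding F W_def[abs_def] by (rule divergence_on_graph[OF w C1_map_M_mat[OF f3] G'])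
    have drift_graph: "grad \<phi> (x, G x) \<bullet> ?A (x, G x) = W x \<bullet> grad V x" for x
    proof -
      have "snd (grad \<phi> (x, G x)) \<bullet> (transpose (?M x) *v grad V x) =
          (?M x *v snd (grad \<phi> (x, G x))) \<bullet> grad V x"
        by (metis inner_commute inner_transpose_matrix_vector)
      then show ?thesis
        by (simp add: A_graph W_def w_def inner_prod_def inner_add_left del: transpose_matrix_vector)
    qed
    have m1: "divergence ?F \<in> borel_measurable borel"
      by (rule borel_measurable_continuous_onI[OF continuous_on_divergence[OF FC1]])
    have "grad \<phi> \<in> borel_measurable borel"
      by (rule borel_measurable_continuous_onI[OF C1_map_continuous[OF \<phi>]])
    moreover have "?A \<in> borel_measurable borel"
      using assms(8) by (intro borel_measurable_A_mod f3 \<open>Ck 1 g\<close>) auto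
    ultimately have m2: "(\<lambda>z. grad \<phi> z \<bullet> ?A z) \<in> borel_measurable borel"
      by (rule borel_measurable_inner)
    show ?thesis
      using parts by (simp add: fp_rhs_def pi_star m1 m2 div_graph drift_graph)
  qed
  have "sets ?p = sets borel" by (simp add: pi_star_def)
  with key pi_star(1) show ?thesis
    by (simp add: stationary_fp_solution_def weak_fp_solution_def)
qed

end
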